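(* Let $L$ be an SPS lattice and let $\mathfrak{p}$ and $\mathfrak{q}$ be distinct prime intervals in $L$. Then $\mathfrak{q}$ is collapsed by $\mathrm{con}(\mathfrak{p})$ if and only if there exist a prime interval $\mathfrak{r}$ such that $\mathfrak{p}$ is up-perspective to $\mathfrak{r}$, and a sequence of prime intervals $\mathfrak{r}_0,\mathfrak{r}_1,\dots,\mathfrak{r}_n$ and a sequence of binary relations $\varrho_1,\dots,\varrho_n$ with $$\mathfrak{r}=\mathfrak{r}_0 \mathbin{\varrho_1} \mathfrak{r}_1 \mathbin{\varrho_2} \mathfrak{r}_2 \cdots \mathbin{\varrho_n} \mathfrak{r}_n=\mathfrak{q},$$ where each relation $\varrho_i$ is either "is down-perspective to" or "swings to". In addition, this sequence also satisfies $$1_{\mathfrak{r}_0}\geq 1_{\mathfrak{r}_1}\geq\dots\geq 1_{\mathfrak{r}_n}.$$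
   Context: An SPS lattice is a (finite) lattice that is slim (contains no sublattice isomorphic to $M_3$, the five-element modular nondistributive lattice), planar (it has a planar Hasse diagram; one such diagram is fixed, and "left" and "right" refer to it), and (upper) semimodular. For an interval $I=[a,b]$ write $0_I=a$, $1_I=b$. A prime interval is an interval $[a,b]$ with $a\prec b$ ($b$ covers $a$). For intervals $I,J$ of $L$: $I$ is down-perspective to $J$ if $1_I=0_I\vee 1_J$ and $0_J=0_I\wedge 1_J$; dually, $I$ is up-perspective to $J$ if $0_I=1_I\wedge 0_J$ and $1_J=1_I\vee 0_J$. (In particular, each interval is both up- and down-perspective to itself.) For prime intervals $\mathfrak{p},\mathfrak{q}$ of an SPS lattice, $\mathfrak{p}$ swings to $\mathfrak{q}$ if $1_{\mathfrak{p}}=1_{\mathfrak{q}}$, the element $1_{\mathfrak{p}}=1_{\mathfrak{q}}$ covers at least three elements, and $0_{\mathfrak{q}}$ is neither the left-most nor the right-most element covered by $1_{\mathfrak{p}}=1_{\mathfrak{q}}$. $\mathrm{con}(\mathfrak{p})$ is the smallest congruence of $L$ identifying $0_{\mathfrak{p}}$ and $1_{\mathfrak{p}}$; a congruence collapses $\mathfrak{q}$ if it identifies $0_{\mathfrak{q}}$ and $1_{\mathfrak{q}}$. *)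

theory Defs
  imports "HOL-Analysis.Analysis"
begin

definition covered_by :: "'a::order \<Rightarrow> 'a \<Rightarrow> bool" where
  "covered_by a b \<longleftrightarrow> a < b \<and> \<not> (\<exists>c. a < c \<and> c < b)"

subsection \<open>Slim semimodular lattices\<close>

definition semimodular :: "'a::lattice itself \<Rightarrow> bool" where
  "semimodular (_ :: 'a itself) \<longleftrightarrow>
     (\<forall>a b c :: 'a. covered_by a b \<longrightarrow>
        sup a c = sup b c \<or> covered_by (sup a c) (sup b c))"

text \<open>The lattice \<open>M\<^sub>3\<close>: three pairwise incomparable atoms between bottom and top.\<close>

datatype m3 = Bot3 | A3 | B3 | C3 | Top3

instantiation m3 :: lattice
begin

definition less_eq_m3 :: "m3 \<Rightarrow> m3 \<Rightarrow> bool" where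
  "x \<le> y \<longleftrightarrow> x = y \<or> x = Bot3 \<or> y = Top3"

definition less_m3 :: "m3 \<Rightarrow> m3 \<Rightarrow> bool" where
  "x < y \<longleftrightarrow> x \<le> y \<and> x \<noteq> (y :: m3)"

definition sup_m3 :: "m3 \<Rightarrow> m3 \<Rightarrow> m3" where
  "sup x y = (if x \<le> y then y else if y \<le> x then x else Top3)"

definition inf_m3 :: "m3 \<Rightarrow> m3 \<Rightarrow> m3" where
  "inf x y = (if x \<le> y then x else if y \<le> x then y else Bot3)"

instance
  by standard
    (auto simp: less_eq_m3_def less_m3_def sup_m3_def inf_m3_def)

end

definition sublattice :: "'a::lattice set \<Rightarrow> bool" where
  "sublattice S \<longleftrightarrow> S \<noteq> {} \<and> (\<forall>x\<in>S. \<forall>y\<in>S. sup x y \<in> S \<and> inf x y \<in> S)"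

definition isomorphic_to_M3 :: "'a::lattice set \<Rightarrow> bool" where
  "isomorphic_to_M3 S \<longleftrightarrow>
     (\<exists>f :: m3 \<Rightarrow> 'a. bij_betw f UNIV S \<and>
        (\<forall>x y. f (sup x y) = sup (f x) (f y) \<and> f (inf x y) = inf (f x) (f y)))"

definition slim :: "'a::lattice itself \<Rightarrow> bool" where
  "slim (_ :: 'a itself) \<longleftrightarrow> \<not> (\<exists>S :: 'a set. sublattice S \<and> isomorphic_to_M3 S)"

subsection \<open>Planar Hasse diagrams\<close>

text \<open>
  A Hasse diagram is given by the position \<open>pos a\<close> in the plane of each element \<open>a\<close>; the edges are
  the straight line segments joining \<open>a\<close> and \<open>b\<close> whenever \<open>b\<close> covers \<open>a\<close>, and \<open>b\<close> is then placed
  higher than \<open>a\<close>.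
\<close>

definition hasse_diagram :: "('a::order \<Rightarrow> real \<times> real) \<Rightarrow> bool" where
  "hasse_diagram pos \<longleftrightarrow>
     inj pos \<and>
     (\<forall>a b. covered_by a b \<longrightarrow> snd (pos a) < snd (pos b)) \<and>
     (\<forall>a b c. covered_by a b \<longrightarrow> pos c \<in> closed_segment (pos a) (pos b) \<longrightarrow> c \<in> {a, b})"

text \<open>Planarity: two distinct edges meet at most in a common endpoint.\<close>

definition planar_diagram :: "('a::order \<Rightarrow> real \<times> real) \<Rightarrow> bool" where
  "planar_diagram pos \<longleftrightarrow>
     hasse_diagram pos \<and>
     (\<forall>a b c d. covered_by a b \<longrightarrow> covered_by c d \<longrightarrow> (a, b) \<noteq> (c, d) \<longrightarrow>
        closed_segment (pos a) (pos b) \<inter> closed_segment (pos c) (pos d)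
          \<subseteq> pos ` ({a, b} \<inter> {c, d}))"

text \<open>
  The lower covers of \<open>x\<close> are ordered from left to right by the order in which a horizontal line
  just below \<open>x\<close> meets the edges leading down from \<open>x\<close>. At distance \<open>t\<close> below \<open>x\<close>, the edge to
  \<open>a\<close> has first coordinate \<open>fst (pos x) + t * drift pos x a\<close>. (The first coordinates of the lower
  covers themselves need not reflect this order, as they may lie at different heights.)
\<close>

definition drift :: "('a \<Rightarrow> real \<times> real) \<Rightarrow> 'a \<Rightarrow> 'a \<Rightarrow> real" where
  "drift pos x a = (fst (pos a) - fst (pos x)) / (snd (pos x) - snd (pos a))"

definition leftmost_lower_cover :: "('a::order \<Rightarrow> real \<times> real) \<Rightarrow> 'a \<Rightarrow> 'a \<Rightarrow> bool" where
  "leftmost_lower_cover pos x a \<longleftrightarrow>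
     covered_by a x \<and> (\<forall>b. covered_by b x \<longrightarrow> drift pos x a \<le> drift pos x b)"

definition rightmost_lower_cover :: "('a::order \<Rightarrow> real \<times> real) \<Rightarrow> 'a \<Rightarrow> 'a \<Rightarrow> bool" where
  "rightmost_lower_cover pos x a \<longleftrightarrow>
     covered_by a x \<and> (\<forall>b. covered_by b x \<longrightarrow> drift pos x b \<le> drift pos x a)"

subsection \<open>Intervals\<close>

text \<open>An interval \<open>[a, b]\<close> is represented by the pair \<open>(a, b)\<close> of its endpoints.\<close>

type_synonym 'a interval = "'a \<times> 'a"

definition prime_interval :: "'a::order interval \<Rightarrow> bool" where
  "prime_interval I \<longleftrightarrow> covered_by (fst I) (snd I)"

definition down_perspective :: "'a::lattice interval \<Rightarrow> 'a interval \<Rightarrow> bool" where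
  "down_perspective I J \<longleftrightarrow> snd I = sup (fst I) (snd J) \<and> fst J = inf (fst I) (snd J)"

definition up_perspective :: "'a::lattice interval \<Rightarrow> 'a interval \<Rightarrow> bool" where
  "up_perspective I J \<longleftrightarrow> fst I = inf (snd I) (fst J) \<and> snd J = sup (snd I) (fst J)"

definition swings :: "('a::order \<Rightarrow> real \<times> real) \<Rightarrow> 'a interval \<Rightarrow> 'a interval \<Rightarrow> bool" where
  "swings pos p q \<longleftrightarrow>
     snd p = snd q \<and>
     3 \<le> card {a. covered_by a (snd q)} \<and>
     \<not> leftmost_lower_cover pos (snd q) (fst q) \<and>
     \<not> rightmost_lower_cover pos (snd q) (fst q)"

subsection \<open>Congruences\<close>

definition lattice_congruence :: "('a::lattice \<times> 'a) set \<Rightarrow> bool" where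
  "lattice_congruence \<theta> \<longleftrightarrow>
     equiv UNIV \<theta> \<and>
     (\<forall>a b c d. (a, b) \<in> \<theta> \<longrightarrow> (c, d) \<in> \<theta> \<longrightarrow>
        (sup a c, sup b d) \<in> \<theta> \<and> (inf a c, inf b d) \<in> \<theta>)"

definition collapses :: "('a \<times> 'a) set \<Rightarrow> 'a interval \<Rightarrow> bool" where
  "collapses \<theta> I \<longleftrightarrow> (fst I, snd I) \<in> \<theta>"

definition con :: "'a::lattice interval \<Rightarrow> ('a \<times> 'a) set" where
  "con p = \<Inter> {\<theta>. lattice_congruence \<theta> \<and> collapses \<theta> p}"

lemma lattice_congruence_con: "lattice_congruence (con p)"
proof -
  have "equiv UNIV (con p)"
  proof (rule equivI)
    show "refl (con p)"
      by (rule refl_onI) (simp add: con_def lattice_congruence_def equiv_def refl_on_def)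
    show "sym (con p)"
      by (rule symI) (auto simp: con_def lattice_congruence_def equiv_def dest: symD)
    show "trans (con p)"
      by (rule transI) (auto simp: con_def lattice_congruence_def equiv_def dest: transD)
  qed simp
  then show ?thesis
    unfolding lattice_congruence_def by (simp add: con_def lattice_congruence_def)
qed

lemma collapses_con: "collapses (con p) p"
  by (auto simp: con_def collapses_def)

lemma con_least: "lattice_congruence \<theta> \<Longrightarrow> collapses \<theta> p \<Longrightarrow> con p \<subseteq> \<theta>"
  by (auto simp: con_def)

subsection \<open>Swing sequences\<close>

text \<open>
  \<open>swing_sequence pos r q n rs \<rho>\<close>: the prime intervals \<open>rs 0, \<dots>, rs n\<close> and the relations
  \<open>\<rho> 1, \<dots>, \<rho> n\<close> satisfy \<open>r = rs 0\<close>, \<open>\<rho> i (rs (i - 1)) (rs i)\<close> for \<open>1 \<le> i \<le> n\<close>, and \<open>rs n = q\<close>.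
\<close>

definition swing_sequence ::
  "('a::lattice \<Rightarrow> real \<times> real) \<Rightarrow> 'a interval \<Rightarrow> 'a interval \<Rightarrow> nat \<Rightarrow>
   (nat \<Rightarrow> 'a interval) \<Rightarrow> (nat \<Rightarrow> 'a interval \<Rightarrow> 'a interval \<Rightarrow> bool) \<Rightarrow> bool" where
  "swing_sequence pos r q n rs \<rho> \<longleftrightarrow>
     (\<forall>i\<le>n. prime_interval (rs i)) \<and> rs 0 = r \<and> rs n = q \<and>
     (\<forall>i\<in>{1..n}. \<rho> i \<in> {down_perspective, swings pos} \<and> \<rho> i (rs (i - 1)) (rs i))"

end

theory Submission imports Defs begin

text \<open>
  Planarity enters through three facts: an element has at most two upper covers, a lower cover \<open>m\<close>
  of \<open>b\<close> lying between the lower covers \<open>l\<close> and \<open>r\<close> satisfies \<open>l \<sqinter> r \<le> m\<close>, and such an \<open>m\<close> has no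
  upper cover other than \<open>b\<close>. The middle one makes a swing preserve collapsing. Conversely, call an
  edge forced by \<open>p\<close> if some swing sequence as in the theorem ends in it. It suffices that the
  forced edges are closed under joins and meets with a fixed element, for then the paths of forced
  edges define a congruence that collapses no other edge. Closure under joins is checked on
  one cover at a time, where the first and the third fact leave only the case of a covering square.
  Closure under meets goes by induction on the top \<open>b\<close> of the edge \<open>[a, b]\<close>: for another lower cover
  \<open>d\<close> of \<open>b\<close>, the interval \<open>[a \<sqinter> d, d]\<close> is a chain whose top edge is reached by swinging to a lower
  cover between \<open>a\<close> and \<open>d\<close>.
\<close>

section \<open>Covers in finite lattices\<close>

lemma covered_by_less: "covered_by a b \<Longrightarrow> a < b"
  by (simp add: covered_by_def)

lemma covered_by_between: "covered_by a b \<Longrightarrow> a \<le> c \<Longrightarrow> c \<le> b \<Longrightarrow> c = a \<or> c = b"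
  unfolding covered_by_def by (metis order_le_less)

lemma ex_upper_cover_le:
  fixes a b :: "'a::{finite, order}"
  assumes "a < b"
  obtains c where "covered_by a c" "c \<le> b"
proof -
  obtain c where c: "c \<in> {x. a < x \<and> x \<le> b}" "\<forall>y\<in>{x. a < x \<and> x \<le> b}. y \<le> c \<longrightarrow> c = y"
    using finite_has_minimal[of "{x. a < x \<and> x \<le> b}"] assms by auto
  then have "covered_by a c"
    unfolding covered_by_def by (auto dest: order.strict_trans2 less_imp_le)
  with c that show thesis by blast
qed

lemma ex_lower_cover_ge:
  fixes a b :: "'a::{finite, order}"
  assumes "a < b"
  obtains c where "covered_by c b" "a \<le> c"
proof -
  obtain c where c: "c \<in> {x. a \<le> x \<and> x < b}" "\<forall>y\<in>{x. a \<le> x \<and> x < b}. c \<le> y \<longrightarrow> c = y"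
    using finite_has_maximal[of "{x. a \<le> x \<and> x < b}"] assms by auto
  then have "covered_by c b"
    unfolding covered_by_def by (auto dest: order.strict_trans1 less_imp_le)
  with c that show thesis by blast
qed

text \<open>Every element strictly above \<open>a\<close> has a lower cover that is still above
  \<open>a\<close>, and passing to it decreases the number of elements strictly below.\<close>

lemma le_cover_induct [consumes 1, case_names base step]:
  fixes a b :: "'a::{finite, order}"
  assumes "a \<le> b" "P a" "\<And>c d. a \<le> c \<Longrightarrow> covered_by c d \<Longrightarrow> d \<le> b \<Longrightarrow> P c \<Longrightarrow> P d"
  shows "P b"
proof -
  have "P x" if "a \<le> x" "x \<le> b" for x
    using that
  proof (induction "card {y. y < x}" arbitrary: x rule: less_induct)
    case less
    show ?case
    proof (cases "a = x")
      case False
      with less.prems(1) have "a < x" by simp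
      then obtain c where c: "covered_by c x" "a \<le> c" by (rule ex_lower_cover_ge)
      have "c < x" using c(1) by (rule covered_by_less)
      then have "{y. y < c} \<subset> {y. y < x}" by (auto intro: order.strict_trans)
      then have "card {y. y < c} < card {y. y < x}" by (intro psubset_card_mono) auto
      moreover have "c \<le> b" using \<open>c < x\<close> less.prems(2) by (rule less_imp_le[OF order.strict_trans2])
      ultimately have "P c" using less.hyps c(2) by blast
      with c less.prems(2) show ?thesis by (intro assms(3)[of c x])
    qed (use assms(2) in simp)
  qed
  with assms(1) show ?thesis by blast
qed

lemma lower_covers_not_le: "covered_by a b \<Longrightarrow> covered_by d b \<Longrightarrow> a \<noteq> d \<Longrightarrow> \<not> a \<le> d"
  unfolding covered_by_def by (metis order_le_less)

lemma upper_covers_not_le: "covered_by a b \<Longrightarrow> covered_by a d \<Longrightarrow> b \<noteq> d \<Longrightarrow> \<not> b \<le> d"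
  unfolding covered_by_def by (metis order_le_less)

lemma sup_lower_covers:
  fixes a b d :: "'a::lattice"
  assumes "covered_by a b" "d \<le> b" "\<not> d \<le> a"
  shows "sup a d = b"
  using covered_by_between[OF assms(1), of "sup a d"] assms covered_by_less[OF assms(1)]
  by (metis less_imp_le sup.cobounded1 sup.cobounded2 sup_least)

lemma inf_upper_covers:
  fixes a b d :: "'a::lattice"
  assumes "covered_by a b" "a \<le> d" "\<not> b \<le> d"
  shows "inf b d = a"
  using covered_by_between[OF assms(1), of "inf b d"] assms covered_by_less[OF assms(1)]
  by (metis less_imp_le inf.cobounded1 inf.cobounded2 inf_greatest)

lemma semimodular_sup_covers:
  fixes a b c :: "'a::lattice"
  assumes "semimodular TYPE('a)" "covered_by a b" "\<not> b \<le> sup a c"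
  shows "covered_by (sup a c) (sup b c)"
  using assms unfolding semimodular_def by (metis sup.cobounded1)

section \<open>Paths in a planar diagram\<close>

text \<open>
  A chain of covers is drawn as the graph of a continuous function of the height. By the
  intermediate value theorem, two such graphs that change sides have a common point, and
  planarity turns it into a common vertex.
\<close>

definition path_within ::
  "('a::order \<Rightarrow> real \<times> real) \<Rightarrow> (real \<Rightarrow> real) \<Rightarrow> 'a \<Rightarrow> 'a \<Rightarrow> 'a set \<Rightarrow> bool" where
  "path_within pos F u v S \<longleftrightarrow>
     continuous_on {snd (pos u)..snd (pos v)} F \<and>
     F (snd (pos u)) = fst (pos u) \<and> F (snd (pos v)) = fst (pos v) \<and>
     (\<forall>t\<in>{snd (pos u)..snd (pos v)}. \<exists>a\<in>S. \<exists>b\<in>S. (a = b \<or> covered_by a b) \<and>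
        (F t, t) \<in> closed_segment (pos a) (pos b))"

text \<open>Measured from the upper end by means of \<open>drift\<close>, so that two edges with a
  common top \<open>b\<close> are ordered by their drifts at every height below
  \<open>b\<close>.\<close>

definition edge_x :: "('a \<Rightarrow> real \<times> real) \<Rightarrow> 'a \<Rightarrow> 'a \<Rightarrow> real \<Rightarrow> real" where
  "edge_x pos a b t = fst (pos b) + (snd (pos b) - t) * drift pos b a"

lemma path_within_mono: "path_within pos F u v S \<Longrightarrow> S \<subseteq> T \<Longrightarrow> path_within pos F u v T"
  unfolding path_within_def by (meson subsetD)

lemma crossing:
  fixes f g :: "real \<Rightarrow> real"
  assumes cont: "continuous_on (closed_segment s t) f" "continuous_on (closed_segment s t) g"
    and "f s < g s" "g t \<le> f t"
  obtains u where "u \<in> closed_segment s t" "f u = g u"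
proof -
  have "connected ((\<lambda>x. f x - g x) ` closed_segment s t)"
    by (intro connected_continuous_image continuous_intros cont connected_segment)
  then have "(0::real) \<in> (\<lambda>x. f x - g x) ` closed_segment s t"
    using connectedD_interval[of _ "f s - g s" "f t - g t" 0] assms by auto
  with that show thesis by force
qed

text \<open>Where \<open>f\<close> and \<open>k\<close> come together, \<open>g\<close> is at most
  \<open>f\<close> or at least \<open>k\<close>, so it has crossed one of them.
  \<open>closed_segment\<close> leaves the order of \<open>s\<close> and \<open>t\<close> open,
  because paths are followed downwards as well as upwards.\<close>

lemma between_crossing:
  fixes f g k :: "real \<Rightarrow> real"
  assumes cont: "continuous_on (closed_segment s t) f" "continuous_on (closed_segment s t) g"
      "continuous_on (closed_segment s t) k"
    and start: "f s < g s" "g s < k s" and finish: "f t = k t"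
  obtains u where "u \<in> closed_segment s t" "g u = f u \<or> g u = k u"
proof (cases "g t \<le> f t")
  case True
  then show thesis using crossing[OF cont(1,2)] start that by metis
next
  case False
  then have "k t \<le> g t" using finish by simp
  from crossing[OF cont(2,3) start(2) this] that show thesis by metis
qed

locale planar_order =
  fixes pos :: "'a::{finite, order} \<Rightarrow> real \<times> real"
  assumes planar: "planar_diagram pos"
begin

abbreviation height :: "'a \<Rightarrow> real" where "height a \<equiv> snd (pos a)"

lemma covered_by_height: "covered_by a b \<Longrightarrow> height a < height b"
  using planar unfolding planar_diagram_def hasse_diagram_def by blast

lemma height_mono: "a \<le> b \<Longrightarrow> height a \<le> height b"
proof (induction rule: le_cover_induct)
  case (step c d)
  then show ?case using covered_by_height[of c d] by simp
qed simp

lemma edge_x_upper: "edge_x pos a b (height b) = fst (pos b)"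
  by (simp add: edge_x_def)

lemma edge_x_lower: "covered_by a b \<Longrightarrow> edge_x pos a b (height a) = fst (pos a)"
  using covered_by_height[of a b] by (simp add: edge_x_def drift_def)

lemma edge_x_in_segment:
  assumes "covered_by a b" "t \<in> {height a..height b}"
  shows "(edge_x pos a b t, t) \<in> closed_segment (pos a) (pos b)"
proof -
  let ?u = "(t - height a) / (height b - height a)"
  have less: "height a < height b" using covered_by_height assms by blast
  have "(edge_x pos a b t, t) = (1 - ?u) *\<^sub>R pos a + ?u *\<^sub>R pos b"
    using less by (simp add: prod_eq_iff edge_x_def drift_def divide_simps) (simp add: algebra_simps)
  moreover have "0 \<le> ?u" "?u \<le> 1" using assms less by auto
  ultimately show ?thesis unfolding in_segment by blast
qed

lemma path_within_edge:
  assumes "covered_by a b"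
  shows "path_within pos (edge_x pos a b) a b {a, b}"
proof -
  have "continuous_on {height a..height b} (edge_x pos a b)"
    unfolding edge_x_def by (intro continuous_intros)
  then show ?thesis
    using assms edge_x_in_segment[OF assms]
    by (auto simp: path_within_def edge_x_upper edge_x_lower)
qed

lemma path_within_glue:
  assumes F: "path_within pos F u v S" and G: "path_within pos G v w T"
    and le: "height u \<le> height v" "height v \<le> height w"
  shows "path_within pos (\<lambda>t. if t \<le> height v then F t else G t) u w (S \<union> T)"
proof -
  let ?H = "\<lambda>t. if t \<le> height v then F t else G t"
  have "continuous_on ({height u..height v} \<union> {height v..height w}) ?H"
    using F G by (intro continuous_on_If) (auto simp: path_within_def)
  moreover have "{height u..height v} \<union> {height v..height w} = {height u..height w}"
    using le by auto
  moreover have "\<exists>a\<in>S \<union> T. \<exists>b\<in>S \<union> T. (a = b \<or> covered_by a b) \<and> (?H t, t) \<in> closed_segment (pos a) (pos b)"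
    if "t \<in> {height u..height w}" for t
  proof (cases "t \<le> height v")
    case True
    then have "\<exists>a\<in>S. \<exists>b\<in>S. (a = b \<or> covered_by a b) \<and> (F t, t) \<in> closed_segment (pos a) (pos b)"
      using F that by (simp add: path_within_def)
    then show ?thesis using True by auto
  next
    case False
    then have "\<exists>a\<in>T. \<exists>b\<in>T. (a = b \<or> covered_by a b) \<and> (G t, t) \<in> closed_segment (pos a) (pos b)"
      using G that by (simp add: path_within_def)
    then show ?thesis using False by auto
  qed
  ultimately show ?thesis
    using F G le by (auto simp: path_within_def)
qed

lemma ex_path_within:
  assumes "a \<le> b"
  obtains F where "path_within pos F a b {a..b}"
proof -
  have "\<exists>F. path_within pos F a b {a..b}"
    using assms
  proof (induction rule: le_cover_induct)
    case base
    have "path_within pos (\<lambda>_. fst (pos a)) a a {a..a}" by (simp add: path_within_def)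
    then show ?case by blast
  next
    case (step c d)
    then obtain F where "path_within pos F a c {a..c}" by blast
    from path_within_glue[OF this path_within_edge[OF step(2)]]
    have "path_within pos (\<lambda>t. if t \<le> height c then F t else edge_x pos c d t) a d ({a..c} \<union> {c, d})"
      using covered_by_height[OF step(2)] height_mono[OF step(1)] by simp
    moreover have "{a..c} \<union> {c, d} \<subseteq> {a..d}"
      using step(1) covered_by_less[OF step(2)] by (auto simp: less_imp_le intro: order.trans)
    ultimately show ?case using path_within_mono by meson
  qed
  with that show thesis by blast
qed

text \<open>The last edge is prescribed so that, close to \<open>b\<close>, the path can be compared
  with other edges into \<open>b\<close>.\<close>

lemma ex_path_through_lower_cover:
  assumes "a \<le> c" "covered_by c b"
  obtains F where "path_within pos F a b (insert b {a..c})"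
    and "\<And>t. height c \<le> t \<Longrightarrow> F t = edge_x pos c b t"
proof -
  obtain F where F: "path_within pos F a c {a..c}" using ex_path_within assms by blast
  let ?H = "\<lambda>t. if t \<le> height c then F t else edge_x pos c b t"
  have "path_within pos ?H a b (insert b {a..c})"
    by (rule path_within_mono[OF path_within_glue[OF F path_within_edge[OF assms(2)]]])
      (use assms height_mono covered_by_height in \<open>auto simp: less_imp_le\<close>)
  \<comment> \<open>At \<open>height c\<close> itself the glued function takes its value from
    \<open>F\<close>; it agrees with the edge there because \<open>F\<close> ends in
    \<open>c\<close>.\<close>
  moreover have "?H t = edge_x pos c b t" if "height c \<le> t" for t
    using that F assms by (auto simp: path_within_def edge_x_lower)
  ultimately show thesis using that by blast
qed

lemma ex_path_through_upper_cover:
  assumes "covered_by a c" "c \<le> b"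
  obtains F where "path_within pos F a b (insert a {c..b})"
    and "\<And>t. t \<le> height c \<Longrightarrow> F t = edge_x pos a c t"
proof -
  obtain F where F: "path_within pos F c b {c..b}" using ex_path_within assms by blast
  let ?H = "\<lambda>t. if t \<le> height c then edge_x pos a c t else F t"
  have "path_within pos ?H a b (insert a {c..b})"
    by (rule path_within_mono[OF path_within_glue[OF path_within_edge[OF assms(1)] F]])
      (use assms height_mono covered_by_height in \<open>auto simp: less_imp_le\<close>)
  with that show thesis by simp
qed

lemma segment_height:
  assumes "(x, t) \<in> closed_segment (pos a) (pos b)" "height a \<le> height b"
  shows "t \<in> {height a..height b}"
proof -
  obtain u where u: "0 \<le> u" "u \<le> 1" "(x, t) = (1 - u) *\<^sub>R pos a + u *\<^sub>R pos b"
    using assms(1) unfolding in_segment by blast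
  then have "t = height a + u * (height b - height a)"
    by (simp add: prod_eq_iff algebra_simps)
  moreover have "u * (height b - height a) \<le> 1 * (height b - height a)"
    using u assms by (intro mult_right_mono) auto
  ultimately show ?thesis using u assms by auto
qed

text \<open>A point common to two different edges is a common vertex, whereas on two equal edges it
  lies between their ends. Asking for one common vertex not above the point and one not below it
  covers both cases, degenerate edges included.\<close>

lemma common_point_common_vertices:
  assumes P: "P \<in> closed_segment (pos a) (pos b)" "P \<in> closed_segment (pos c) (pos d)"
    and ab: "a = b \<or> covered_by a b" and cd: "c = d \<or> covered_by c d"
  shows "(\<exists>w\<in>{a, b} \<inter> {c, d}. height w \<le> snd P) \<and> (\<exists>w\<in>{a, b} \<inter> {c, d}. snd P \<le> height w)"
proof -
  have vertex: "y \<in> {u, v}" if "pos y \<in> closed_segment (pos u) (pos v)" "u = v \<or> covered_by u v" for y u v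
    using that planar unfolding planar_diagram_def hasse_diagram_def
    by (metis closed_segment_idem injD insertCI singletonD)
  show ?thesis
  proof (cases "a = b \<or> c = d")
    case True
    then obtain w where w: "P = pos w" "w \<in> {a, b} \<inter> {c, d}"
    proof
      assume "a = b"
      with P(1) have "P = pos a" by simp
      with vertex[of a c d] P(2) cd \<open>a = b\<close> that show thesis by auto
    next
      assume "c = d"
      with P(2) have "P = pos c" by simp
      with vertex[of c a b] P(1) ab \<open>c = d\<close> that show thesis by auto
    qed
    then show ?thesis by auto
  next
    case False
    with ab cd have cov: "covered_by a b" "covered_by c d" by auto
    show ?thesis
    proof (cases "(a, b) = (c, d)")
      case True
      have "snd P \<in> {height a..height b}"
        using segment_height[of "fst P" "snd P" a b] P covered_by_height[OF cov(1)] by simp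
      with True show ?thesis by auto
    next
      case False
      with cov P planar have "P \<in> pos ` ({a, b} \<inter> {c, d})"
        unfolding planar_diagram_def by blast
      then show ?thesis by auto
    qed
  qed
qed

lemma paths_common_vertices:
  assumes "path_within pos F u v S" "path_within pos G u' v' T" "F t = G t"
    and "t \<in> {height u..height v}" "t \<in> {height u'..height v'}"
  shows "\<exists>w\<in>S \<inter> T. height w \<le> t" and "\<exists>w\<in>S \<inter> T. t \<le> height w"
proof -
  obtain a b where ab: "a \<in> S" "b \<in> S" "a = b \<or> covered_by a b" "(F t, t) \<in> closed_segment (pos a) (pos b)"
    using assms unfolding path_within_def by blast
  obtain c d where cd: "c \<in> T" "d \<in> T" "c = d \<or> covered_by c d" "(G t, t) \<in> closed_segment (pos c) (pos d)"
    using assms unfolding path_within_def by blast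
  from common_point_common_vertices[OF ab(4) cd(4)[folded assms(3)] ab(3) cd(3)] ab cd
  show "\<exists>w\<in>S \<inter> T. height w \<le> t" "\<exists>w\<in>S \<inter> T. t \<le> height w" by auto
qed

text \<open>The only vertex common to the two edges is \<open>b\<close>, which lies higher than
  \<open>t\<close>.\<close>

lemma edge_x_lower_covers_neq:
  assumes "covered_by a b" "covered_by c b" "a \<noteq> c" "height a \<le> t" "height c \<le> t" "t < height b"
  shows "edge_x pos a b t \<noteq> edge_x pos c b t"
proof
  assume eq: "edge_x pos a b t = edge_x pos c b t"
  have "\<exists>w\<in>{a, b} \<inter> {c, b}. height w \<le> t"
    using paths_common_vertices(1)[OF path_within_edge path_within_edge eq] assms by auto
  with assms covered_by_less show False by auto
qed

lemma edge_x_upper_covers_neq: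
  assumes "covered_by b a" "covered_by b c" "a \<noteq> c" "t \<le> height a" "t \<le> height c" "height b < t"
  shows "edge_x pos b a t \<noteq> edge_x pos b c t"
proof
  assume eq: "edge_x pos b a t = edge_x pos b c t"
  have "\<exists>w\<in>{b, a} \<inter> {b, c}. t \<le> height w"
    using paths_common_vertices(2)[OF path_within_edge path_within_edge eq] assms by auto
  with assms covered_by_less show False by auto
qed

lemma edge_x_less_iff_drift:
  "t < height b \<Longrightarrow> edge_x pos a b t < edge_x pos c b t \<longleftrightarrow> drift pos b a < drift pos b c"
  by (simp add: edge_x_def)

lemma drift_lower_covers_neq:
  assumes "covered_by a b" "covered_by c b" "a \<noteq> c"
  shows "drift pos b a \<noteq> drift pos b c"
proof -
  have "max (height a) (height c) < height b" using assms covered_by_height by simp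
  with edge_x_lower_covers_neq[OF assms, of "max (height a) (height c)"] show ?thesis
    by (auto simp: edge_x_def)
qed

end

section \<open>Covers lying between two others in a planar lattice\<close>

locale planar_lattice = planar_order pos
  for pos :: "'a::{finite, lattice} \<Rightarrow> real \<times> real"
begin

text \<open>Paths from \<open>inf l r\<close> to \<open>b\<close> through \<open>l\<close> and
  through \<open>r\<close> enclose a region, and the edge from \<open>m\<close> arrives at
  \<open>b\<close> inside it. A path going down from \<open>m\<close> must meet the boundary in a
  vertex above \<open>inf l r\<close>; a path going up from \<open>m\<close> through
  \<open>y\<close> must meet it in a vertex below \<open>b\<close>.\<close>

lemma middle_lower_cover:
  assumes cov: "covered_by l b" "covered_by m b" "covered_by r b"
    and drift: "drift pos b l < drift pos b m" "drift pos b m < drift pos b r"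
  shows inf_le_middle_lower_cover: "inf l r \<le> m"
    and middle_lower_cover_unique_upper_cover: "covered_by m y \<Longrightarrow> y = b"
proof -
  let ?e = "inf l r"
  have neq: "\<not> m \<le> l" "\<not> m \<le> r" using lower_covers_not_le cov drift by blast+
  \<comment> \<open>At this height all three edges into \<open>b\<close> are present, so that the
    drifts decide the order of the paths.\<close>
  define t0 where "t0 = max (height l) (max (height m) (height r))"
  have t0: "height l \<le> t0" "height m \<le> t0" "height r \<le> t0" "t0 < height b"
    using cov covered_by_height by (auto simp: t0_def)
  have e: "height ?e \<le> height l" "height ?e \<le> height r" by (simp_all add: height_mono)
  obtain L where L: "path_within pos L ?e b (insert b {?e..l})"
    and Ledge: "\<And>t. height l \<le> t \<Longrightarrow> L t = edge_x pos l b t"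
    using ex_path_through_lower_cover[OF inf.cobounded1 cov(1)] by blast
  obtain R where R: "path_within pos R ?e b (insert b {?e..r})"
    and Redge: "\<And>t. height r \<le> t \<Longrightarrow> R t = edge_x pos r b t"
    using ex_path_through_lower_cover[OF inf.cobounded2 cov(3)] by blast
  have LR: "L (height ?e) = R (height ?e)" "L (height b) = R (height b)"
    using L R by (auto simp: path_within_def)
  have start: "L t0 < edge_x pos m b t0" "edge_x pos m b t0 < R t0"
    using t0 drift by (simp_all add: Ledge Redge edge_x_less_iff_drift)
  show le: "?e \<le> m"
  proof -
    \<comment> \<open>Continuing down to \<open>inf m ?e\<close> makes the path pass through all
      heights down to that of \<open>?e\<close>, where \<open>L\<close> and \<open>R\<close> have
      met.\<close>
    let ?d = "inf m ?e"
    have d: "height ?d \<le> height ?e" by (intro height_mono inf.cobounded2)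
    obtain M where M: "path_within pos M ?d b (insert b {?d..m})"
      and Medge: "\<And>t. height m \<le> t \<Longrightarrow> M t = edge_x pos m b t"
      using ex_path_through_lower_cover[OF inf.cobounded1 cov(2)] by blast
    have seg: "closed_segment t0 (height ?e) = {height ?e..t0}"
      using e t0 by (simp add: closed_segment_eq_real_ivl)
    obtain t where t: "t \<in> {height ?e..t0}" "M t = L t \<or> M t = R t"
    proof (rule between_crossing[of t0 "height ?e" L M R])
      show "continuous_on (closed_segment t0 (height ?e)) L"
        "continuous_on (closed_segment t0 (height ?e)) M"
        "continuous_on (closed_segment t0 (height ?e)) R"
        unfolding seg using L M R t0 d
        by (auto simp: path_within_def elim!: continuous_on_subset)
    qed (use start LR t0 Medge seg in auto)
    from t(2) obtain k where k: "k \<in> {l, r}" "\<exists>w\<in>insert b {?d..m} \<inter> insert b {?e..k}. height w \<le> t"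
    proof
      assume "M t = L t"
      with paths_common_vertices(1)[OF M L this] t(1) t0 d that[of l] show thesis by auto
    next
      assume "M t = R t"
      with paths_common_vertices(1)[OF M R this] t(1) t0 d that[of r] show thesis by auto
    qed
    \<comment> \<open>The common vertex is not \<open>b\<close>, which lies higher than
      \<open>t\<close>, so it belongs to both intervals.\<close>
    with t0 t(1) obtain w where "?e \<le> w" "w \<le> m" by force
    then show ?thesis by (rule order.trans)
  qed
  show "y = b" if y: "covered_by m y"
  proof -
    have "?e \<noteq> m" using neq(1) by (metis inf.cobounded1)
    have "height ?e \<le> height m" using le by (rule height_mono)
    let ?M = "edge_x pos m b"
    have M: "path_within pos ?M m b {m, b}" by (rule path_within_edge[OF cov(2)])
    \<comment> \<open>Following the edge from \<open>b\<close> down to \<open>m\<close>, it stays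
      inside: a common vertex with a boundary path could only be \<open>m\<close>, but
      \<open>m\<close> is below neither \<open>l\<close> nor \<open>r\<close>.\<close>
    have strict: "L (height m) < fst (pos m) \<and> fst (pos m) < R (height m)"
    proof -
      have seg: "closed_segment t0 (height m) = {height m..t0}"
        using t0 by (simp add: closed_segment_eq_real_ivl)
      have cont: "continuous_on (closed_segment t0 (height m)) L"
        "continuous_on (closed_segment t0 (height m)) ?M"
        "continuous_on (closed_segment t0 (height m)) R"
        unfolding seg using L M R t0 \<open>height ?e \<le> height m\<close>
        by (auto simp: path_within_def elim!: continuous_on_subset)
      have no_crossing: False
        if K: "path_within pos K ?e b (insert b {?e..k})" and "\<not> m \<le> k"
          and t: "t \<in> {height m..t0}" "?M t = K t" for K k t
      proof -
        have "\<exists>w\<in>{m, b} \<inter> insert b {?e..k}. height w \<le> t"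
          using paths_common_vertices(1)[OF M K t(2)] t(1) t0 \<open>height ?e \<le> height m\<close> by auto
        with \<open>\<not> m \<le> k\<close> t(1) t0 covered_by_less[OF cov(2)] show False by auto
      qed
      have m: "?M (height m) = fst (pos m)" using cov(2) by (rule edge_x_lower)
      show ?thesis
      proof (intro conjI; rule ccontr)
        assume "\<not> L (height m) < fst (pos m)"
        with m crossing[OF cont(1,2) start(1)] obtain t where "t \<in> {height m..t0}" "L t = ?M t"
          unfolding seg by auto
        with no_crossing[OF L neq(1), of t] show False by simp
      next
        assume "\<not> fst (pos m) < R (height m)"
        with m crossing[OF cont(2,3) start(2)] obtain t where "t \<in> {height m..t0}" "?M t = R t"
          unfolding seg by auto
        with no_crossing[OF R neq(2), of t] show False by simp
      qed
    qed
    \<comment> \<open>The path through \<open>y\<close> is continued to \<open>sup y b\<close> so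
      that it reaches the height of \<open>b\<close>, where \<open>L\<close> and \<open>R\<close>
      meet again.\<close>
    let ?f = "sup y b"
    have f: "height b \<le> height ?f" by (simp add: height_mono)
    obtain N where N: "path_within pos N m ?f (insert m {y..?f})"
      using ex_path_through_upper_cover[OF y sup.cobounded1] by blast
    have seg: "closed_segment (height m) (height b) = {height m..height b}"
      using t0 by (simp add: closed_segment_eq_real_ivl)
    obtain t where t: "t \<in> {height m..height b}" "N t = L t \<or> N t = R t"
    proof (rule between_crossing[of "height m" "height b" L N R])
      show "continuous_on (closed_segment (height m) (height b)) L"
        "continuous_on (closed_segment (height m) (height b)) N"
        "continuous_on (closed_segment (height m) (height b)) R"
        unfolding seg using L N R f \<open>height ?e \<le> height m\<close>
        by (auto simp: path_within_def elim!: continuous_on_subset)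
    qed (use strict N LR seg in \<open>auto simp: path_within_def\<close>)
    from t(2) obtain k where k: "k \<in> {l, r}" "\<exists>w\<in>insert m {y..?f} \<inter> insert b {?e..k}. t \<le> height w"
    proof
      assume "N t = L t"
      with paths_common_vertices(2)[OF N L this] t(1) f \<open>height ?e \<le> height m\<close> that[of l] show thesis by auto
    next
      assume "N t = R t"
      with paths_common_vertices(2)[OF N R this] t(1) f \<open>height ?e \<le> height m\<close> that[of r] show thesis by auto
    qed
    then obtain w where w: "w \<in> insert m {y..?f}" "w \<in> insert b {?e..k}" by blast
    have "k < b" using k(1) cov[THEN covered_by_less] by auto
    with w(2) have "w \<le> b" by auto
    have "w \<noteq> m" using w(2) k(1) neq covered_by_less[OF cov(2)] by auto
    with w(1) have "y \<le> w" by simp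
    then have "y \<le> b" using \<open>w \<le> b\<close> by (rule order.trans)
    then show "y = b" using covered_by_between[OF cov(2), of y] y covered_by_less[OF y]
      by (auto simp: less_imp_le)
  qed
qed

text \<open>The paths from \<open>a\<close> through \<open>l\<close> and \<open>r\<close> meet in
  \<open>sup l r\<close>, so the path through \<open>m\<close>, which starts between them, hits one
  of them in a vertex above \<open>m\<close>. The order is read off at a common height
  \<open>t0\<close>, since \<open>drift\<close> refers to edges with a common upper end.\<close>

lemma middle_upper_cover:
  assumes cov: "covered_by a l" "covered_by a m" "covered_by a r"
    and t0: "t0 = Min (height ` {l, m, r})"
    and less: "edge_x pos a l t0 < edge_x pos a m t0" "edge_x pos a m t0 < edge_x pos a r t0"
  shows "m \<le> sup l r"
proof -
  let ?b = "sup l r" and ?f = "sup m (sup l r)"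
  have t0: "t0 \<le> height l" "t0 \<le> height m" "t0 \<le> height r" "height a < t0"
    using cov covered_by_height by (auto simp: t0)
  have b: "height l \<le> height ?b" "height ?b \<le> height ?f"
    by (intro height_mono sup.cobounded1 sup.cobounded2)+
  obtain L where L: "path_within pos L a ?b (insert a {l..?b})"
    and Ledge: "\<And>t. t \<le> height l \<Longrightarrow> L t = edge_x pos a l t"
    using ex_path_through_upper_cover[OF cov(1) sup.cobounded1] by blast
  obtain R where R: "path_within pos R a ?b (insert a {r..?b})"
    and Redge: "\<And>t. t \<le> height r \<Longrightarrow> R t = edge_x pos a r t"
    using ex_path_through_upper_cover[OF cov(3) sup.cobounded2] by blast
  obtain M where M: "path_within pos M a ?f (insert a {m..?f})"
    and Medge: "\<And>t. t \<le> height m \<Longrightarrow> M t = edge_x pos a m t"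
    using ex_path_through_upper_cover[OF cov(2) sup.cobounded1] by blast
  have seg: "closed_segment t0 (height ?b) = {t0..height ?b}"
    using b t0 by (simp add: closed_segment_eq_real_ivl)
  obtain t where t: "t \<in> {t0..height ?b}" "M t = L t \<or> M t = R t"
  proof (rule between_crossing[of t0 "height ?b" L M R])
    show "continuous_on (closed_segment t0 (height ?b)) L"
      "continuous_on (closed_segment t0 (height ?b)) M"
      "continuous_on (closed_segment t0 (height ?b)) R"
      unfolding seg using L M R t0 b
      by (auto simp: path_within_def elim!: continuous_on_subset)
    show "L (height ?b) = R (height ?b)" using L R by (simp add: path_within_def)
    show "L t0 < M t0" "M t0 < R t0" using less t0 by (simp_all add: Ledge Medge Redge)
  qed (use seg in auto)
  from t(2) obtain k where k: "k \<in> {l, r}" "\<exists>w\<in>insert a {m..?f} \<inter> insert a {k..?b}. t \<le> height w"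
  proof
    assume "M t = L t"
    with paths_common_vertices(2)[OF M L this] t(1) t0 b that[of l] show thesis by auto
  next
    assume "M t = R t"
    with paths_common_vertices(2)[OF M R this] t(1) t0 b that[of r] show thesis by auto
  qed
  then obtain w where w: "w \<in> insert a {m..?f}" "w \<in> insert a {k..?b}" "t \<le> height w" by blast
  then have "w \<noteq> a" using t(1) t0 by auto
  with w have "m \<le> w" "w \<le> ?b" by auto
  then show ?thesis by (rule order.trans)
qed

text \<open>At the height of the lowest of the three covers, the edges from \<open>a\<close> have
  distinct horizontal positions; sorting these positions yields the middle one.\<close>

lemma ex_middle_upper_cover:
  fixes a x y z :: 'a
  assumes "covered_by a x" "covered_by a y" "covered_by a z" "x \<noteq> y" "y \<noteq> z" "x \<noteq> z"
  obtains l m r where "{l, m, r} = {x, y, z}" "m \<le> sup l r"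
proof -
  note result = that
  define t0 where "t0 = Min (height ` {x, y, z})"
  let ?f = "\<lambda>v. edge_x pos a v t0"
  have "t0 \<le> height v" if "v \<in> {x, y, z}" for v using that by (auto simp: t0_def)
  moreover have "height a < t0" using assms(1-3) covered_by_height by (auto simp: t0_def)
  ultimately have neq: "?f x \<noteq> ?f y" "?f y \<noteq> ?f z" "?f x \<noteq> ?f z"
    using edge_x_upper_covers_neq assms by auto
  have middle: thesis if "{l, m, r} = {x, y, z}" "?f l < ?f m" "?f m < ?f r" for l m r
  proof -
    have cov: "covered_by a v" if "v \<in> {l, m, r}" for v
      using that unfolding \<open>{l, m, r} = {x, y, z}\<close> using assms by auto
    have "t0 = Min (height ` {l, m, r})" unfolding t0_def that(1) ..
    then have "m \<le> sup l r"
      using that(2,3) by (intro middle_upper_cover[of a l m r t0] cov) simp_all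
    with that(1) show thesis by (rule result)
  qed
  consider "?f x < ?f y" "?f y < ?f z" | "?f x < ?f z" "?f z < ?f y" | "?f y < ?f x" "?f x < ?f z"
    | "?f y < ?f z" "?f z < ?f x" | "?f z < ?f x" "?f x < ?f y" | "?f z < ?f y" "?f y < ?f x"
    using neq by linarith
  then show thesis
  proof cases
    case 1 then show thesis by (intro middle[of x y z]) auto
  next
    case 2 then show thesis by (intro middle[of x z y]) auto
  next
    case 3 then show thesis by (intro middle[of y x z]) auto
  next
    case 4 then show thesis by (intro middle[of y z x]) auto
  next
    case 5 then show thesis by (intro middle[of z x y]) auto
  next
    case 6 then show thesis by (intro middle[of z y x]) auto
  qed
qed

end

section \<open>Slim semimodular planar lattices\<close>

lemma M3_not_slim:
  fixes o' a b c i :: "'a::lattice"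
  assumes "o' \<noteq> a" "o' \<noteq> b" "o' \<noteq> c" "a \<noteq> b" "b \<noteq> c" "a \<noteq> c" "i \<noteq> a" "i \<noteq> b" "i \<noteq> c" "i \<noteq> o'"
    and "inf a b = o'" "inf b c = o'" "inf a c = o'" "sup a b = i" "sup b c = i" "sup a c = i"
  shows "\<not> slim TYPE('a)"
proof -
  define f where "f = (\<lambda>x. case x of Bot3 \<Rightarrow> o' | A3 \<Rightarrow> a | B3 \<Rightarrow> b | C3 \<Rightarrow> c | Top3 \<Rightarrow> i)"
  have le: "o' \<le> a" "o' \<le> b" "o' \<le> c" "a \<le> i" "b \<le> i" "c \<le> i"
    using assms by (metis inf.cobounded1 inf.cobounded2 sup.cobounded1 sup.cobounded2)+
  then have le': "o' \<le> i" by (metis order.trans)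
  have hom: "f (sup x y) = sup (f x) (f y) \<and> f (inf x y) = inf (f x) (f y)" for x y
    using assms le le'
    by (cases x; cases y)
      (simp_all add: f_def sup_m3_def inf_m3_def less_eq_m3_def sup.absorb1 sup.absorb2
        inf.absorb1 inf.absorb2 sup.commute inf.commute)
  have "inj f"
    by (rule injI) (use assms in \<open>auto simp: f_def split: m3.splits\<close>)
  then have "bij_betw f UNIV (range f)" by (simp add: inj_on_imp_bij_betw)
  with hom have "isomorphic_to_M3 (range f)" unfolding isomorphic_to_M3_def by blast
  moreover have "sublattice (range f)"
    by (auto simp: sublattice_def simp flip: hom[THEN conjunct1] hom[THEN conjunct2])
  ultimately show ?thesis unfolding slim_def by blast
qed

locale SPS_lattice = planar_lattice pos
  for pos :: "'a::{finite, lattice} \<Rightarrow> real \<times> real" +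
  assumes slim: "slim TYPE('a)" and semimodular: "semimodular TYPE('a)"
begin

lemma sup_upper_covers:
  fixes a x y :: 'a
  assumes "covered_by a x" "covered_by a y" "x \<noteq> y"
  shows "covered_by x (sup x y)"
proof -
  have "\<not> y \<le> x" using assms upper_covers_not_le by metis
  moreover have "sup a x = x" using assms covered_by_less by (metis less_imp_le sup.absorb2)
  ultimately show ?thesis
    using semimodular_sup_covers[OF semimodular assms(2), of x] by (simp add: sup.commute)
qed

text \<open>Of three upper covers the middle one \<open>m\<close> is below \<open>sup l r\<close>.
  By semimodularity both \<open>sup l m\<close> and \<open>sup l r\<close> cover \<open>l\<close>,
  hence they coincide; the same holds at \<open>r\<close>. So \<open>l\<close>, \<open>m\<close>,
  \<open>r\<close> have equal pairwise joins and meet pairwise in \<open>a\<close>, which is an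
  M3.\<close>

lemma at_most_two_upper_covers:
  fixes a x y z :: 'a
  assumes cov: "covered_by a x" "covered_by a y" "covered_by a z" and neq: "x \<noteq> y" "y \<noteq> z" "x \<noteq> z"
  shows False
proof -
  obtain l m r where lmr: "{l, m, r} = {x, y, z}" "m \<le> sup l r"
    using ex_middle_upper_cover[OF cov neq] by blast
  have "covered_by a v" if "v \<in> {l, m, r}" for v
    using that unfolding lmr(1) using cov by auto
  then have c: "covered_by a l" "covered_by a m" "covered_by a r" by auto
  have "card {l, m, r} = 3" unfolding lmr(1) using neq by simp
  then have n: "l \<noteq> m" "m \<noteq> r" "l \<noteq> r" by (auto simp: card_insert_if split: if_splits)
  note s = sup_upper_covers[OF c(1,2) n(1)] sup_upper_covers[OF c(1,3) n(3)]
    sup_upper_covers[OF c(3,2) n(2)[symmetric]] sup_upper_covers[OF c(3,1) n(3)[symmetric]]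
  have le: "sup l m \<le> sup l r" "sup r m \<le> sup r l" using lmr(2) by (simp_all add: sup.commute)
  have eq: "sup l m = sup l r" "sup r m = sup r l"
    using covered_by_between[OF s(2) _ le(1)] covered_by_between[OF s(4) _ le(2)]
      covered_by_less[OF s(1)] covered_by_less[OF s(3)] by auto
  have infs: "inf l m = a" "inf m r = a" "inf l r = a"
    using inf_upper_covers[OF c(1), of m] inf_upper_covers[OF c(2), of r] inf_upper_covers[OF c(1), of r]
      upper_covers_not_le c n c[THEN covered_by_less, THEN less_imp_le] by blast+
  have "l < sup l r" "m < sup l r" "r < sup l r"
    using s[THEN covered_by_less] sup_upper_covers[OF c(2,1) n(1)[symmetric], THEN covered_by_less] eq
    by (simp_all add: sup.commute)
  then have "\<not> slim TYPE('a)"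
    using n infs eq c[THEN covered_by_less]
    by (intro M3_not_slim[of a l m r "sup l r"]) (auto simp: sup.commute)
  with slim show False by contradiction
qed

text \<open>Otherwise \<open>inf x y\<close> has two different upper covers below \<open>d\<close>,
  one under \<open>x\<close> and one under \<open>y\<close>. A cover \<open>f\<close> of
  \<open>inf a d\<close> below \<open>a\<close> is not below \<open>d\<close>, and joining it to
  \<open>inf x y\<close> gives a third upper cover.\<close>

lemma inf_interval_chain:
  fixes a d x y :: 'a
  assumes "\<not> a \<le> d" "inf a d \<le> x" "x \<le> d" "inf a d \<le> y" "y \<le> d"
  shows "x \<le> y \<or> y \<le> x"
proof (rule ccontr)
  assume neg: "\<not> ?thesis"
  let ?m = "inf x y"
  have m: "inf a d \<le> ?m" "?m \<le> d" using assms by (auto intro: le_infI1)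
  have "?m < x" "?m < y" using neg by (simp_all add: less_le_not_le)
  then obtain x' y' where x': "covered_by ?m x'" "x' \<le> x" and y': "covered_by ?m y'" "y' \<le> y"
    using ex_upper_cover_le by metis
  have "inf a d < a" using assms(1) by (simp_all add: less_le_not_le)
  then obtain f where f: "covered_by (inf a d) f" "f \<le> a" by (rule ex_upper_cover_le)
  have "\<not> f \<le> d" using f covered_by_less by (metis inf_greatest leD)
  then have "covered_by ?m (sup f ?m)"
    using semimodular_sup_covers[OF semimodular f(1), of ?m] m
    by (metis order.trans sup.absorb2)
  moreover have "\<not> sup f ?m \<le> d" using \<open>\<not> f \<le> d\<close> by simp
  then have "sup f ?m \<noteq> x'" "sup f ?m \<noteq> y'" using x' y' assms by (metis order.trans)+
  moreover have "x' \<noteq> y'" using x' y' covered_by_less by (metis inf_greatest leD)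
  ultimately show False using at_most_two_upper_covers x' y' by metis
qed

text \<open>Whichever of three lower covers lies in the middle is above the meet of the other two.
  The hypotheses rule this out for \<open>a\<close> and for \<open>d\<close>, so \<open>h\<close> is
  in the middle.\<close>

lemma middle_of_lower_covers:
  fixes a d h b :: 'a
  assumes cov: "covered_by a b" "covered_by d b" "covered_by h b"
    and neq: "a \<noteq> d" and a: "\<not> inf h d \<le> a" and d: "\<not> inf h a \<le> d"
  shows "swings pos (a, b) (h, b)"
proof -
  let ?D = "drift pos b"
  have ne: "h \<noteq> a" "h \<noteq> d" using a d by auto
  have "?D a \<noteq> ?D d" "?D h \<noteq> ?D a" "?D h \<noteq> ?D d"
    using drift_lower_covers_neq cov neq ne by auto
  moreover have "\<not> (?D h < ?D a \<and> ?D a < ?D d)" "\<not> (?D d < ?D a \<and> ?D a < ?D h)"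
    using inf_le_middle_lower_cover[of h b a d] inf_le_middle_lower_cover[of d b a h] cov a
    by (auto simp: inf.commute)
  moreover have "\<not> (?D h < ?D d \<and> ?D d < ?D a)" "\<not> (?D a < ?D d \<and> ?D d < ?D h)"
    using inf_le_middle_lower_cover[of h b d a] inf_le_middle_lower_cover[of a b d h] cov d
    by (auto simp: inf.commute)
  ultimately have "?D a < ?D h \<and> ?D h < ?D d \<or> ?D d < ?D h \<and> ?D h < ?D a" by linarith
  then have "\<not> leftmost_lower_cover pos b h" "\<not> rightmost_lower_cover pos b h"
    using cov unfolding leftmost_lower_cover_def rightmost_lower_cover_def by (meson leD)+
  moreover have "card {a, d, h} \<le> card {x. covered_by x b}"
    using cov by (intro card_mono) auto
  then have "3 \<le> card {x. covered_by x b}" using neq ne by simp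
  ultimately show ?thesis by (simp add: swings_def)
qed

end

section \<open>Swing steps\<close>

text \<open>Both ends are required to be prime, so that the closure \<open>swing_reach\<close> from
  a prime interval passes through prime intervals only, as in \<open>swing_sequence\<close>.\<close>

definition swing_step :: "('a::lattice \<Rightarrow> real \<times> real) \<Rightarrow> 'a interval \<Rightarrow> 'a interval \<Rightarrow> bool" where
  "swing_step pos I J \<longleftrightarrow> prime_interval I \<and> prime_interval J \<and> (down_perspective I J \<or> swings pos I J)"

abbreviation swing_reach :: "('a::lattice \<Rightarrow> real \<times> real) \<Rightarrow> 'a interval \<Rightarrow> 'a interval \<Rightarrow> bool" where
  "swing_reach pos \<equiv> (swing_step pos)\<^sup>*\<^sup>*"

lemma swing_reach_iff_sequence:
  assumes "prime_interval r"
  shows "swing_reach pos r q \<longleftrightarrow> (\<exists>n rs \<rho>. swing_sequence pos r q n rs \<rho>)"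
proof
  assume "swing_reach pos r q"
  then obtain n where "(swing_step pos ^^ n) r q" by (metis rtranclp_imp_relpowp)
  then obtain f where f: "f 0 = r" "f n = q" "\<And>i. i < n \<Longrightarrow> swing_step pos (f i) (f (Suc i))"
    by (auto simp: relpowp_fun_conv)
  have "prime_interval (f i)" if "i \<le> n" for i
    using f assms that by (cases i) (auto simp: swing_step_def)
  \<comment> \<open>The relation numbered \<open>i\<close> belongs to the step from
    \<open>f (i - 1)\<close> to \<open>f i\<close>; where both relations hold, either choice would
    do.\<close>
  moreover define \<rho> where
    "\<rho> i = (if down_perspective (f (i - 1)) (f i) then down_perspective else swings pos)" for i
  have "\<rho> i \<in> {down_perspective, swings pos} \<and> \<rho> i (f (i - 1)) (f i)" if "i \<in> {1..n}" for i
    using f(3)[of "i - 1"] that by (auto simp: \<rho>_def swing_step_def)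
  ultimately show "\<exists>n rs \<rho>. swing_sequence pos r q n rs \<rho>"
    using f unfolding swing_sequence_def by blast
next
  assume "\<exists>n rs \<rho>. swing_sequence pos r q n rs \<rho>"
  then obtain n rs \<rho> where seq: "swing_sequence pos r q n rs \<rho>" by blast
  have "swing_step pos (rs i) (rs (Suc i))" if "i < n" for i
  proof -
    have "Suc i \<in> {1..n}" using that by simp
    with seq have "\<rho> (Suc i) \<in> {down_perspective, swings pos}" "\<rho> (Suc i) (rs i) (rs (Suc i))"
      unfolding swing_sequence_def by (metis diff_Suc_1)+
    then have "down_perspective (rs i) (rs (Suc i)) \<or> swings pos (rs i) (rs (Suc i))" by auto
    then show ?thesis using seq that by (simp add: swing_sequence_def swing_step_def)
  qed
  then have "(swing_step pos ^^ n) r q"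
    using seq by (auto simp: relpowp_fun_conv swing_sequence_def)
  then show "swing_reach pos r q" by (rule relpowp_imp_rtranclp)
qed

section \<open>Swing sequences to edges below a given edge\<close>

context SPS_lattice
begin

text \<open>Since \<open>b\<close> covers \<open>a\<close> and \<open>v\<close> is not below
  \<open>a\<close>, the join of \<open>a\<close> and \<open>v\<close> can only be \<open>b\<close>;
  since \<open>v\<close> covers \<open>u\<close>, their meet can only be \<open>u\<close>.\<close>

lemma swing_step_down:
  assumes "covered_by a b" "covered_by u v" "v \<le> b" "u \<le> a" "\<not> v \<le> a"
  shows "swing_step pos (a, b) (u, v)"
  using assms sup_lower_covers[OF assms(1,3,5)] inf_upper_covers[OF assms(2,4,5)]
  by (simp add: swing_step_def prime_interval_def down_perspective_def inf.commute)

text \<open>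
  The edge \<open>[u, v]\<close> is reached through an edge \<open>[s, t]\<close> of the chain \<open>[a \<sqinter> d, d]\<close> with \<open>v \<le> t\<close>
  and \<open>s \<sqinter> v \<le> u\<close>, to which the induction hypothesis applies because \<open>t < b\<close>.
\<close>

lemma swing_reach_reduce:
  fixes a b c d u v :: 'a
  assumes IH: "\<And>t s x y. t < b \<Longrightarrow> covered_by s t \<Longrightarrow> y \<le> t \<Longrightarrow> \<not> y \<le> s \<Longrightarrow> inf s y \<le> x \<Longrightarrow> covered_by x y
       \<Longrightarrow> swing_reach pos (s, t) (x, y)"
    and d: "\<And>s t. inf a d \<le> s \<Longrightarrow> t \<le> d \<Longrightarrow> covered_by s t \<Longrightarrow> swing_reach pos (a, b) (s, t)"
    and "covered_by a b" "covered_by d b" "v \<le> d" "inf a v \<le> u" "covered_by u v"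
  shows "swing_reach pos (a, b) (u, v)"
proof -
  have "\<not> v \<le> a"
    using assms(6,7) covered_by_less by (metis inf.absorb2 leD)
  \<comment> \<open>A maximal \<open>s\<close> in this set is taken; an upper cover \<open>t\<close>
    of \<open>s\<close> below \<open>d\<close> is then forced to lie above \<open>v\<close>.\<close>
  let ?A = "{s. inf a d \<le> s \<and> s \<le> d \<and> \<not> v \<le> s}"
  have "inf a d \<in> ?A" using \<open>\<not> v \<le> a\<close> by simp
  then have "\<exists>s\<in>?A. \<forall>y\<in>?A. s \<le> y \<longrightarrow> s = y"
    by (intro finite_has_maximal finite) blast
  then obtain s where s: "s \<in> ?A" "\<And>y. y \<in> ?A \<Longrightarrow> s \<le> y \<Longrightarrow> s = y" by blast
  then have "s < d" using assms(5) by (auto simp: order.strict_iff_order)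
  then obtain t where t: "covered_by s t" "t \<le> d" by (rule ex_upper_cover_le)
  have "s < t" using t(1) by (rule covered_by_less)
  have "v \<le> t"
  proof (rule ccontr)
    assume "\<not> v \<le> t"
    with s(1) t \<open>s < t\<close> have "s = t" by (intro s(2)) (auto intro: order.trans)
    with \<open>s < t\<close> show False by simp
  qed
  have "t < b" using t(2) covered_by_less[OF assms(4)] by (rule order.strict_trans1)
  have "\<not> a \<le> v"
  proof
    assume "a \<le> v"
    moreover have "v < b" using assms(5) covered_by_less[OF assms(4)] by (rule order.strict_trans1)
    ultimately have "v = a" using covered_by_between[OF assms(3), of v] by (auto simp: less_imp_le)
    with \<open>\<not> v \<le> a\<close> show False by simp
  qed
  moreover have "inf a v \<le> inf s v"
  proof -
    have "inf a v \<le> inf a d" using assms(5) by (auto intro: le_infI2)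
    also have "inf a d \<le> s" using s(1) by simp
    finally show ?thesis by simp
  qed
  moreover have "u < v" using assms(7) by (rule covered_by_less)
  \<comment> \<open>Both elements lie in the chain from \<open>inf a v\<close> to \<open>v\<close>.
    If \<open>u\<close> is the smaller one, then it equals \<open>inf s v\<close>, because
    \<open>v\<close> covers \<open>u\<close> and \<open>v\<close> is not below
    \<open>s\<close>.\<close>
  ultimately have "inf s v \<le> u \<or> u \<le> inf s v"
    using assms(6) by (intro inf_interval_chain[of a v]) auto
  moreover have "inf s v = u" if "u \<le> inf s v"
    using covered_by_between[OF assms(7) that inf.cobounded2] s(1) by (auto simp: inf.absorb_iff2)
  ultimately have "inf s v \<le> u" by auto
  have "swing_reach pos (a, b) (s, t)" using d s(1) t by auto
  also have "swing_reach pos (s, t) (u, v)"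
    using IH[OF \<open>t < b\<close> t(1) \<open>v \<le> t\<close> _ \<open>inf s v \<le> u\<close> assms(7)] s(1) by auto
  finally show ?thesis .
qed

text \<open>Only the lowest edge of the chain from \<open>inf a d\<close> to \<open>d\<close> has
  its bottom below \<open>a\<close>, and it is reached by one down-perspectivity. For a higher edge
  another lower cover \<open>h\<close> of \<open>b\<close> takes over, in an induction on the number
  of elements above \<open>inf a d\<close>. \<open>IH\<close> is the hypothesis of an outer
  induction on \<open>b\<close>.\<close>

lemma swing_reach_lower_cover:
  fixes a b d s t :: 'a
  assumes IH: "\<And>t s x y. t < b \<Longrightarrow> covered_by s t \<Longrightarrow> y \<le> t \<Longrightarrow> \<not> y \<le> s \<Longrightarrow> inf s y \<le> x \<Longrightarrow> covered_by x y
       \<Longrightarrow> swing_reach pos (s, t) (x, y)"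
    and a: "covered_by a b" and "covered_by d b" "d \<noteq> a" "inf a d \<le> s" "t \<le> d" "covered_by s t"
  shows "swing_reach pos (a, b) (s, t)"
  using assms(3-)
proof (induction "card {x. inf a d < x}" arbitrary: d s t rule: less_induct)
  case less
  note d = less.prems(1)
  have "s < t" using less.prems by (blast dest: covered_by_less)
  have "d < b" "a < b" using d a by (auto dest: covered_by_less)
  show ?case
  proof (cases "s \<le> a")
    case True
    have "\<not> t \<le> a" using True less.prems(3,4) \<open>s < t\<close> by (metis inf_greatest leD order.strict_trans1)
    with True show ?thesis
      using swing_step_down[OF a less.prems(5)] less.prems(4) \<open>d < b\<close> by (meson less_imp_le order.trans r_into_rtranclp)
  next
    case False
    let ?e = "inf a d"
    have "\<not> a \<le> d" using lower_covers_not_le[OF a d] less.prems(2) by simp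
    then have "?e < a" by (simp_all add: less_le_not_le)
    then obtain f where f: "covered_by ?e f" "f \<le> a" by (rule ex_upper_cover_le)
    have "\<not> f \<le> d" using f covered_by_less by (metis inf_greatest leD)
    obtain g where g: "covered_by g d" "s \<le> g" "t < d \<Longrightarrow> t \<le> g"
    proof (cases "t = d")
      case True
      with less.prems(5) that[of s] show thesis by simp
    next
      case False
      then have "t < d" using less.prems(4) by simp
      then obtain g where "covered_by g d" "t \<le> g" by (rule ex_lower_cover_ge)
      with that[of g] \<open>s < t\<close> show thesis by (auto intro: less_imp_le order.trans)
    qed
    have "?e \<le> g" using less.prems(3) g(2) by (rule order.trans)
    have "g < d" using g(1) by (rule covered_by_less)
    have fd: "sup d f = b"
    proof -
      have "covered_by d (sup f d)"
        using semimodular_sup_covers[OF semimodular f(1), of d] \<open>\<not> f \<le> d\<close> by (simp add: sup.absorb2)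
      moreover have "sup f d \<le> b" using f(2) \<open>a < b\<close> \<open>d < b\<close> by (auto intro: order.trans)
      ultimately show ?thesis using covered_by_between[OF d, of "sup f d"] covered_by_less
        by (metis less_imp_le less_irrefl sup.commute)
    qed
    \<comment> \<open>A lower cover of \<open>b\<close> between \<open>a\<close> and \<open>d\<close>. If \<open>t = d\<close>, swing to \<open>[h, b]\<close>; otherwise replace \<open>d\<close> by \<open>h\<close>,
      which strictly increases the meet with \<open>a\<close>.\<close>
    define h where "h = sup g f"
    have "\<not> f \<le> g" using \<open>\<not> f \<le> d\<close> \<open>g < d\<close> by (meson less_imp_le order.trans)
    have "h \<noteq> b"
    proof
      assume "h = b"
      have "covered_by g (sup f g)"
        using semimodular_sup_covers[OF semimodular f(1), of g] \<open>\<not> f \<le> g\<close> \<open>?e \<le> g\<close> by (simp add: sup.absorb2)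
      with \<open>h = b\<close> have "covered_by g b" by (simp add: h_def sup.commute)
      with \<open>g < d\<close> \<open>d < b\<close> show False by (auto simp: covered_by_def)
    qed
    \<comment> \<open>Joining \<open>f\<close> to both ends of the cover of \<open>g\<close> by
      \<open>d\<close> gives \<open>h\<close> and \<open>b\<close>, which differ.\<close>
    then have h: "covered_by h b"
      using semimodular g(1) fd unfolding semimodular_def h_def by metis
    have "h < b" using h by (rule covered_by_less)
    have "f \<le> h" "g \<le> h" by (simp_all add: h_def)
    have "\<not> g \<le> a" using False g(2) by (meson order.trans)
    then have "h \<noteq> a" using \<open>g \<le> h\<close> by auto
    have "h \<noteq> d" using \<open>f \<le> h\<close> \<open>\<not> f \<le> d\<close> by auto
    show ?thesis
    proof (cases "t = d")
      case True
      have "g = s" using covered_by_between[OF less.prems(5) g(2)] \<open>g < d\<close> True by (auto simp: less_imp_le)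
      have "\<not> inf h d \<le> a" using \<open>g \<le> h\<close> \<open>g < d\<close> \<open>\<not> g \<le> a\<close> by (meson inf_greatest less_imp_le order.trans)
      moreover have "\<not> inf h a \<le> d" using \<open>f \<le> h\<close> f(2) \<open>\<not> f \<le> d\<close> by (meson inf_greatest order.trans)
      ultimately have "swings pos (a, b) (h, b)"
        using middle_of_lower_covers[OF a d h] less.prems(2) by simp
      then have "swing_step pos (a, b) (h, b)"
        using a h by (simp add: swing_step_def prime_interval_def)
      moreover have "swing_step pos (h, b) (s, t)"
        using swing_step_down[OF h less.prems(5)] \<open>g \<le> h\<close> \<open>g = s\<close> True \<open>d < b\<close>
          lower_covers_not_le[OF d h] \<open>h \<noteq> d\<close> by simp
      ultimately show ?thesis by (meson r_into_rtranclp rtranclp.rtrancl_into_rtrancl)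
    next
      case False
      then have "t \<le> g" using g(3) less.prems(4) by simp
      then have "t \<le> h" using \<open>g \<le> h\<close> by (rule order.trans)
      have "?e < inf a h"
        using f covered_by_less[OF f(1)] \<open>f \<le> h\<close> by (meson inf_greatest order.strict_trans2)
      then have "{x. inf a h < x} \<subset> {x. ?e < x}" by (auto intro: order.strict_trans)
      then have "card {x. inf a h < x} < card {x. ?e < x}" by (intro psubset_card_mono) auto
      note reach = less.hyps[OF this h \<open>h \<noteq> a\<close>]
      have "inf a t \<le> ?e" using less.prems(4) by (auto intro: le_infI2)
      then have "inf a t \<le> s" using less.prems(3) by (rule order.trans)
      \<comment> \<open>The edge \<open>[s, t]\<close> is not in the chain from
        \<open>inf a h\<close> to \<open>h\<close>, as \<open>f\<close> is below
        \<open>inf a h\<close> but not below \<open>d\<close>. It is therefore reached through that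
        chain by \<open>swing_reach_reduce\<close>, with \<open>h\<close> in the place of
        \<open>d\<close>.\<close>
      then show ?thesis
        using swing_reach_reduce[OF IH reach a h \<open>t \<le> h\<close>] less.prems(5) by blast
    qed
  qed
qed

text \<open>Induction on the number of elements below \<open>b\<close> supplies the
  \<open>IH\<close> of the two preceding lemmas. If \<open>v = b\<close>, then \<open>[u, v]\<close>
  is \<open>[a, b]\<close>; otherwise \<open>v\<close> is below a lower cover \<open>d\<close> of
  \<open>b\<close>, and \<open>[u, v]\<close> is reached through the chain from
  \<open>inf a d\<close> to \<open>d\<close>.\<close>

lemma swing_reach_inf:
  fixes a b u v :: 'a
  assumes "covered_by a b" "v \<le> b" "\<not> v \<le> a" "inf a v \<le> u" "covered_by u v"
  shows "swing_reach pos (a, b) (u, v)"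
  using assms
proof (induction "card {x. x < b}" arbitrary: a b u v rule: less_induct)
  case less
  have IH: "swing_reach pos (s, t) (x, y)"
    if "t < b" "covered_by s t" "y \<le> t" "\<not> y \<le> s" "inf s y \<le> x" "covered_by x y" for t s x y
  proof -
    have "{x. x < t} \<subset> {x. x < b}" using that(1) by (auto intro: order.strict_trans)
    then have "card {x. x < t} < card {x. x < b}" by (intro psubset_card_mono) auto
    from less.hyps[OF this that(2-)] show ?thesis .
  qed
  show ?case
  proof (cases "v = b")
    case True
    then have "a \<le> u" using less.prems covered_by_less by (metis inf.absorb1 less_imp_le)
    moreover have "u < b" using covered_by_less[OF less.prems(5)] True by simp
    ultimately have "u = a" using covered_by_between[OF less.prems(1), of u] by (auto simp: less_imp_le)
    with True show ?thesis by simp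
  next
    case False
    with less.prems(2) have "v < b" by simp
    then obtain d where d: "covered_by d b" "v \<le> d" by (rule ex_lower_cover_ge)
    have "d \<noteq> a" using d(2) less.prems(3) by auto
    show ?thesis
      by (rule swing_reach_reduce[OF IH swing_reach_lower_cover[OF IH] less.prems(1) d less.prems(4,5)])
        (use less.prems d \<open>d \<noteq> a\<close> in auto)
  qed
qed

section \<open>Edges forced by a prime interval\<close>

definition swing_forced :: "'a interval \<Rightarrow> 'a interval \<Rightarrow> bool" where
  "swing_forced p q \<longleftrightarrow> (\<exists>r. prime_interval r \<and> up_perspective p r \<and> swing_reach pos r q)"

lemma swing_forced_prime:
  assumes "swing_forced p q"
  shows "prime_interval q"
proof -
  obtain r where "swing_reach pos r q" "prime_interval r"
    using assms unfolding swing_forced_def by blast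
  then show ?thesis by (cases rule: rtranclp.cases) (auto simp: swing_step_def)
qed

text \<open>Induction along the sequence. At its start \<open>p\<close> is also up-perspective to
  the joined edge. After a down-perspectivity from \<open>q'\<close>, the joined edge is again
  down-perspective from \<open>q'\<close> if \<open>y\<close> is below \<open>fst q'\<close>; if
  not, \<open>q' = q\<close>, since otherwise a cover of \<open>fst q\<close> below
  \<open>fst q'\<close> would be a third upper cover. After a swing the bottom of \<open>q\<close>
  has no second upper cover \<open>y\<close>.\<close>

lemma swing_forced_sup_cover:
  assumes "swing_forced p (a, b)" "covered_by a y" "y \<noteq> b"
  shows "swing_forced p (y, sup b y)"
proof -
  obtain r where r: "swing_reach pos r (a, b)" "prime_interval r" "up_perspective p r"
    using assms(1) unfolding swing_forced_def by blast
  have "swing_forced p (y, sup (snd q) y)"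
    if "swing_reach pos r q" "covered_by (fst q) y" "y \<noteq> snd q" for q y
    using that
  proof (induction arbitrary: y rule: rtranclp_induct)
    case base
    have r_cov: "covered_by (fst r) (snd r)" using r(2) by (simp add: prime_interval_def)
    then have "\<not> snd r \<le> y" using upper_covers_not_le base by metis
    then have "inf (snd r) y = fst r"
      using inf_upper_covers[OF r_cov] covered_by_less[OF base(1)] by (simp add: less_imp_le)
    have up: "fst p = inf (snd p) (fst r)" "snd r = sup (snd p) (fst r)"
      using r(3) by (simp_all add: up_perspective_def)
    have "fst r \<le> y" using covered_by_less[OF base(1)] by (rule less_imp_le)
    then have "sup (snd r) y = sup (snd p) y"
      unfolding up(2) by (simp add: sup.assoc sup.absorb2)
    moreover have "snd p \<le> snd r" unfolding up(2) by simp
    then have "inf (snd p) y = fst p"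
      unfolding up(1) using \<open>inf (snd r) y = fst r\<close> by (metis inf.absorb1 inf.assoc)
    ultimately have "up_perspective p (y, sup (snd r) y)"
      by (simp add: up_perspective_def)
    moreover have "prime_interval (y, sup (snd r) y)"
      using sup_upper_covers[OF base(1) r_cov base(2)] by (simp add: prime_interval_def sup.commute)
    ultimately show ?case unfolding swing_forced_def by blast
  next
    case (step q' q)
    have cov: "covered_by (fst q') (snd q')" "covered_by (fst q) (snd q)"
      using step(2) by (simp_all add: swing_step_def prime_interval_def)
    consider "down_perspective q' q" | "swings pos q' q"
      using step(2) by (auto simp: swing_step_def)
    then show ?case
    proof cases
      case 1
      then have down: "snd q' = sup (fst q') (snd q)" "fst q = inf (fst q') (snd q)"
        by (simp_all add: down_perspective_def)
      have "\<not> snd q \<le> y" using upper_covers_not_le[OF cov(2) step(4)] step(5) by simp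
      have "\<not> snd q \<le> fst q'" using down(1) covered_by_less[OF cov(1)] by (auto simp: sup.absorb1)
      show ?thesis
      proof (cases "y \<le> fst q'")
        case True
        have cov_y: "covered_by y (sup (snd q) y)"
          using sup_upper_covers[OF step(4) cov(2) step(5)] by (simp add: sup.commute)
        have "sup (snd q) y \<le> snd q'"
          unfolding down(1) using True by (simp add: sup.coboundedI1)
        then have "swing_step pos q' (y, sup (snd q) y)"
          using swing_step_down[OF cov(1) cov_y _ True] \<open>\<not> snd q \<le> fst q'\<close> by simp
        moreover have "swing_reach pos r q'" by (rule step(1))
        ultimately show ?thesis
          using r unfolding swing_forced_def by (meson rtranclp.rtrancl_into_rtrancl)
      next
        case False
        have "fst q \<le> fst q'" unfolding down(2) by simp
        show ?thesis
        proof (cases "fst q = fst q'")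
          case True
          then have "snd q' = snd q"
            using down by (metis inf.absorb_iff1 inf.commute sup.absorb2 inf.cobounded1 inf.cobounded2)
          with True have "q' = q" by (simp add: prod_eq_iff)
          with step(3)[of y] step(4,5) show ?thesis by simp
        next
          case False
          with \<open>fst q \<le> fst q'\<close> have "fst q < fst q'" by simp
          then obtain z where z: "covered_by (fst q) z" "z \<le> fst q'" by (rule ex_upper_cover_le)
          have "z \<noteq> y" "z \<noteq> snd q" using z \<open>\<not> y \<le> fst q'\<close> \<open>\<not> snd q \<le> fst q'\<close> by auto
          with at_most_two_upper_covers[OF z(1) step(4) cov(2)] step(5) show ?thesis by blast
        qed
      qed
    next
      case 2
      then obtain l r where "covered_by l (snd q)" "covered_by r (snd q)"
          "drift pos (snd q) l < drift pos (snd q) (fst q)" "drift pos (snd q) (fst q) < drift pos (snd q) r"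
        using cov(2) unfolding swings_def leftmost_lower_cover_def rightmost_lower_cover_def
        by (meson not_le)
      then have "y = snd q" using middle_lower_cover_unique_upper_cover cov(2) step(4) by blast
      with step(5) show ?thesis by contradiction
    qed
  qed
  from this[OF r(1), of y] assms(2,3) show ?thesis by simp
qed

text \<open>Going up from \<open>a\<close> to \<open>w\<close> by covers, the next element never
  equals the top of the current edge, since \<open>b\<close> is not below \<open>w\<close>.\<close>

lemma swing_forced_sup:
  assumes "swing_forced p (a, b)" "a \<le> w" "\<not> b \<le> w"
  shows "swing_forced p (w, sup b w)"
  using assms(2,3)
proof (induction rule: le_cover_induct)
  case base
  have "a \<le> b"
    using swing_forced_prime[OF assms(1)] by (simp add: prime_interval_def covered_by_less less_imp_le)
  with assms(1) show ?case by (simp add: sup.absorb1)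
next
  case (step c d)
  have "c \<le> d" using covered_by_less[OF step(2)] by (rule less_imp_le)
  then have "\<not> b \<le> c" using step(5) by (meson order.trans)
  then have "swing_forced p (c, sup b c)" by (rule step(4))
  moreover have "d \<noteq> sup b c" using step(5) by auto
  ultimately have "swing_forced p (d, sup (sup b c) d)" using step(2) by (intro swing_forced_sup_cover)
  with \<open>c \<le> d\<close> show ?case by (simp add: sup.assoc sup.absorb2)
qed

lemma swing_forced_inf:
  assumes "swing_forced p (a, b)" "inf a c \<le> u" "v \<le> inf b c" "covered_by u v"
  shows "swing_forced p (u, v)"
proof -
  have cov: "covered_by a b" using swing_forced_prime[OF assms(1)] by (simp add: prime_interval_def)
  have "v \<le> b" "v \<le> c" using assms(3) by simp_all
  then have "inf a v \<le> u" using assms(2) by (meson inf_mono order.refl order.trans)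
  moreover have "u < v" using assms(4) by (rule covered_by_less)
  ultimately have "\<not> v \<le> a" by (auto simp: inf.absorb2)
  then have "swing_reach pos (a, b) (u, v)"
    using swing_reach_inf cov \<open>v \<le> b\<close> \<open>inf a v \<le> u\<close> assms(4) by blast
  with assms(1) show ?thesis unfolding swing_forced_def by (meson rtranclp_trans)
qed

text \<open>For a down-perspectivity, take meets with \<open>snd J\<close>. For a swing, take meets
  with a lower cover \<open>k\<close> of the common top on the other side of \<open>fst J\<close>,
  then joins with \<open>fst J\<close>.\<close>

lemma swing_step_collapses:
  assumes cong: "lattice_congruence \<theta>" and "collapses \<theta> I" "swing_step pos I J"
  shows "collapses \<theta> J"
proof -
  have refl: "(x, x) \<in> \<theta>" for x
    using cong by (auto simp: lattice_congruence_def equiv_def refl_on_def)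
  have inf: "(inf (fst I) x, inf (snd I) x) \<in> \<theta>" for x
    using cong assms(2) refl[of x] unfolding lattice_congruence_def collapses_def by blast
  have cov: "covered_by (fst I) (snd I)" "covered_by (fst J) (snd J)"
    using assms(3) by (simp_all add: swing_step_def prime_interval_def)
  consider "down_perspective I J" | "swings pos I J"
    using assms(3) by (auto simp: swing_step_def)
  then show ?thesis
  proof cases
    case 1
    then have "snd J \<le> snd I" by (simp add: down_perspective_def)
    with 1 inf[of "snd J"] show ?thesis
      by (simp add: collapses_def down_perspective_def inf.absorb2)
  next
    case 2
    let ?b = "snd J" and ?m = "fst J" and ?a = "fst I"
    let ?D = "drift pos ?b"
    have b: "snd I = ?b" using 2 by (simp add: swings_def)
    obtain l r where lr: "covered_by l ?b" "covered_by r ?b" "?D l < ?D ?m" "?D ?m < ?D r"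
      using 2 cov(2) unfolding swings_def leftmost_lower_cover_def rightmost_lower_cover_def
      by (meson not_le)
    have a: "covered_by ?a ?b" using cov(1) b by simp
    \<comment> \<open>The meet of \<open>?a\<close> with \<open>k\<close> is absorbed by
      \<open>?m\<close>, while the join of \<open>k\<close> with \<open>?m\<close> is
      \<open>?b\<close>.\<close>
    have opposite: "collapses \<theta> J" if "covered_by k ?b" "inf ?a k \<le> ?m" "k \<noteq> ?m" for k
    proof -
      have "k \<le> ?b" using covered_by_less[OF that(1)] by (rule less_imp_le)
      then have "(inf ?a k, k) \<in> \<theta>" using inf[of k] b by (simp add: inf.absorb2)
      then have "(sup (inf ?a k) ?m, sup k ?m) \<in> \<theta>"
        using cong refl[of ?m] unfolding lattice_congruence_def by blast
      moreover have "sup k ?m = ?b"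
        using sup_lower_covers[OF cov(2) \<open>k \<le> ?b\<close>] lower_covers_not_le[OF that(1) cov(2)] that(3)
        by (simp add: sup.commute)
      ultimately show ?thesis using that(2) by (simp add: collapses_def sup.absorb2)
    qed
    consider "?D ?a < ?D ?m" | "?D ?m < ?D ?a" | "?a = ?m"
      using drift_lower_covers_neq[OF a cov(2)] by fastforce
    then show ?thesis
    proof cases
      case 1
      then show ?thesis
        using opposite[OF lr(2)] inf_le_middle_lower_cover[OF a cov(2) lr(2)] lr(4) by auto
    next
      case 2
      then show ?thesis
        using opposite[OF lr(1)] inf_le_middle_lower_cover[OF lr(1) cov(2) a] lr(3)
        by (auto simp: inf.commute)
    next
      case 3
      with b assms(2) show ?thesis by (simp add: collapses_def)
    qed
  qed
qed

lemma swing_forced_collapses: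
  assumes "swing_forced p q"
  shows "collapses (con p) q"
proof -
  obtain r where r: "swing_reach pos r q" "up_perspective p r"
    using assms unfolding swing_forced_def by blast
  have "(fst p, snd p) \<in> con p" using collapses_con[of p] by (simp add: collapses_def)
  moreover have "(fst r, fst r) \<in> con p"
    using lattice_congruence_con[of p] by (auto simp: lattice_congruence_def equiv_def refl_on_def)
  ultimately have "(sup (fst p) (fst r), sup (snd p) (fst r)) \<in> con p"
    using lattice_congruence_con[of p] unfolding lattice_congruence_def by blast
  moreover have "fst p \<le> fst r" "snd r = sup (snd p) (fst r)"
    using r(2) by (simp_all add: up_perspective_def)
  ultimately have "collapses (con p) r" by (simp add: collapses_def sup.absorb2)
  with r(1) show ?thesis
    by (induction rule: rtranclp_induct) (auto intro: swing_step_collapses lattice_congruence_con)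
qed

end

section \<open>Congruences and sets of edges\<close>

text \<open>Two elements are related when a path of edges from \<open>E\<close>, traversed in either
  direction, joins them. In a semimodular lattice the join of an edge with an element is at most an
  edge, but the meet may be a longer interval; hence the different shapes of
  \<open>sup_closed\<close> and \<open>inf_closed\<close>.\<close>

lemma ex_congruence_collapsing_edges:
  fixes E :: "'a::{finite, lattice} interval \<Rightarrow> bool"
  assumes prime: "\<And>I. E I \<Longrightarrow> prime_interval I"
    and sup_closed: "\<And>a b w. E (a, b) \<Longrightarrow> a \<le> w \<Longrightarrow> \<not> b \<le> w \<Longrightarrow> E (w, sup b w)"
    and inf_closed: "\<And>a b c u v. E (a, b) \<Longrightarrow> inf a c \<le> u \<Longrightarrow> v \<le> inf b c \<Longrightarrow> covered_by u v \<Longrightarrow> E (u, v)"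
  obtains \<theta> where "lattice_congruence \<theta>" "\<And>I. prime_interval I \<Longrightarrow> collapses \<theta> I \<longleftrightarrow> E I"
proof -
  define R where "R = (\<lambda>x y. E (x, y) \<or> E (y, x))"
  have "symp R" by (auto simp: R_def symp_def)
  then have sym: "R\<^sup>*\<^sup>* y x" if "R\<^sup>*\<^sup>* x y" for x y
    using symp_rtranclp that by (metis sympD)
  have less: "a < b" if "E (a, b)" for a b
    using prime[OF that] by (simp add: prime_interval_def covered_by_less)
  \<comment> \<open>Joining with \<open>c\<close> has the same effect as joining with
    \<open>sup a c\<close>, which is above \<open>a\<close> as \<open>sup_closed\<close>
    demands.\<close>
  have edge_sup: "R\<^sup>*\<^sup>* (sup a c) (sup b c)" if "E (a, b)" for a b c
  proof (cases "b \<le> sup a c")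
    case True
    then have "sup a c = sup b c"
      using less[OF that] by (intro order.antisym) (auto intro: le_supI1)
    then show ?thesis by simp
  next
    case False
    have "a \<le> b" using less[OF that] by (rule less_imp_le)
    then have "sup b (sup a c) = sup b c" by (simp add: sup.absorb1 flip: sup.assoc)
    with sup_closed[OF that _ False] show ?thesis by (auto simp: R_def)
  qed
  have edge_inf: "R\<^sup>*\<^sup>* (inf a c) (inf b c)" if "E (a, b)" for a b c
  proof -
    have "inf a c \<le> inf b c" using less[OF that] by (intro inf_mono) auto
    then show ?thesis
    proof (induction rule: le_cover_induct)
      case (step x y)
      then have "R x y" using inf_closed[OF that] by (auto simp: R_def)
      with step show ?case by simp
    qed simp
  qed
  have R_sup: "R\<^sup>*\<^sup>* (sup x c) (sup y c)" if "R\<^sup>*\<^sup>* x y" for x y c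
    using that
  proof (induction rule: rtranclp_induct)
    case (step y z)
    then have "R\<^sup>*\<^sup>* (sup y c) (sup z c)" using edge_sup sym by (auto simp: R_def)
    with step show ?case by simp
  qed simp
  have R_inf: "R\<^sup>*\<^sup>* (inf x c) (inf y c)" if "R\<^sup>*\<^sup>* x y" for x y c
    using that
  proof (induction rule: rtranclp_induct)
    case (step y z)
    then have "R\<^sup>*\<^sup>* (inf y c) (inf z c)" using edge_inf sym by (auto simp: R_def)
    with step show ?case by simp
  qed simp
  define \<theta> where "\<theta> = {(x, y). R\<^sup>*\<^sup>* x y}"
  have "equiv UNIV \<theta>"
  proof (rule equivI)
    show "refl \<theta>" by (simp add: \<theta>_def refl_on_def)
    show "sym \<theta>" using sym by (simp add: \<theta>_def sym_def)
    show "trans \<theta>" unfolding trans_def \<theta>_def by (auto intro: rtranclp_trans)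
  qed simp
  moreover have "(sup a c, sup b d) \<in> \<theta> \<and> (inf a c, inf b d) \<in> \<theta>"
    if "(a, b) \<in> \<theta>" "(c, d) \<in> \<theta>" for a b c d
  proof -
    have "R\<^sup>*\<^sup>* (sup a c) (sup b c)" "R\<^sup>*\<^sup>* (sup b c) (sup b d)"
      "R\<^sup>*\<^sup>* (inf a c) (inf b c)" "R\<^sup>*\<^sup>* (inf b c) (inf b d)"
      using R_sup[of a b c] R_sup[of c d b] R_inf[of a b c] R_inf[of c d b] that
      by (simp_all add: \<theta>_def sup.commute inf.commute)
    then show ?thesis unfolding \<theta>_def by (auto intro: rtranclp_trans)
  qed
  ultimately have "lattice_congruence \<theta>" unfolding lattice_congruence_def by blast
  moreover have "collapses \<theta> I \<longleftrightarrow> E I" if "prime_interval I" for I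
  proof
    assume "E I"
    then show "collapses \<theta> I" by (cases I) (auto simp: collapses_def \<theta>_def R_def)
  next
    assume "collapses \<theta> I"
    obtain u v where I: "I = (u, v)" by (cases I)
    have uv: "covered_by u v" using that by (simp add: I prime_interval_def)
    then have "u < v" by (rule covered_by_less)
    \<comment> \<open>The monotone map \<open>x \<mapsto> u \<squnion> (x \<sqinter> v)\<close> takes only the values \<open>u\<close> and \<open>v\<close> on the path from \<open>u\<close> to \<open>v\<close>,
      so that it jumps along some edge of \<open>E\<close>.\<close>
    let ?f = "\<lambda>x. sup u (inf x v)"
    have f: "?f x = u \<or> ?f x = v" for x
      using covered_by_between[OF uv, of "?f x"] \<open>u < v\<close> by (simp add: less_imp_le)
    \<comment> \<open>Climb from \<open>inf a v\<close> to \<open>inf b v\<close> by covers, all of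
      which are in \<open>E\<close>. The first of them to leave the elements below \<open>u\<close>
      becomes \<open>[u, v]\<close> when joined with \<open>u\<close>.\<close>
    have jump: "E (u, v)" if "E (a, b)" "?f a = u" "?f b = v" for a b
    proof -
      have "inf a v \<le> u" using that(2) by (simp add: sup.absorb_iff1)
      have "inf a v \<le> inf b v" using less[OF that(1)] by (intro inf_mono) auto
      then have "inf b v \<le> u \<or> E (u, v)"
      proof (induction rule: le_cover_induct)
        case base
        show ?case using \<open>inf a v \<le> u\<close> by simp
      next
        case (step c d)
        show ?case
        proof (cases "d \<le> u \<or> E (u, v)")
          case False
          with step have "c \<le> u" by blast
          have "E (c, d)" using inf_closed[OF that(1)] step by blast
          then have E: "E (u, sup d u)" using sup_closed \<open>c \<le> u\<close> False by blast
          have "sup d u \<le> v" using step(3) \<open>u < v\<close> by (simp add: less_imp_le)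
          then have "sup d u = v"
            using covered_by_between[OF uv, of "sup d u"] less[OF E] by auto
          with E show ?thesis by simp
        qed simp
      qed
      moreover have "\<not> inf b v \<le> u" using that(3) \<open>u < v\<close> by (auto simp: sup.absorb1)
      ultimately show ?thesis by blast
    qed
    have "?f x = v \<longrightarrow> E (u, v)" if "R\<^sup>*\<^sup>* u x" for x
      using that
    proof (induction rule: rtranclp_induct)
      case base
      have "?f u \<noteq> v" using \<open>u < v\<close> by auto
      then show ?case by blast
    next
      case (step y z)
      show ?case
      proof (intro impI)
        assume fz: "?f z = v"
        show "E (u, v)"
        proof (cases "?f y = v")
          case False
          then have fy: "?f y = u" using f by blast
          \<comment> \<open>By monotonicity of \<open>?f\<close>, the edge on which the value
            changes from \<open>u\<close> to \<open>v\<close> is traversed upwards.\<close>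
          have "\<not> E (z, y)"
          proof
            assume "E (z, y)"
            then have "?f z \<le> ?f y" by (intro sup_mono inf_mono) (auto dest: less)
            with fy fz \<open>u < v\<close> show False by simp
          qed
          with step(2) jump[OF _ fy fz] show ?thesis by (auto simp: R_def)
        qed (use step in simp)
      qed
    qed
    from this[of v] \<open>collapses \<theta> I\<close> \<open>u < v\<close> show "E I"
      by (simp add: I collapses_def \<theta>_def sup.absorb2 less_imp_le)
  qed
  ultimately show thesis by (rule that)
qed

theorem mainTheorem1:
  fixes pos :: "'a::{finite, lattice} \<Rightarrow> real \<times> real"
    and p q :: "'a interval"
  assumes "slim TYPE('a)"
    and "semimodular TYPE('a)"
    and "planar_diagram pos"
    and "prime_interval p" and "prime_interval q" and "p \<noteq> q"
  shows "(collapses (con p) q \<longleftrightarrow>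
            (\<exists>r n rs \<rho>. prime_interval r \<and> up_perspective p r \<and> swing_sequence pos r q n rs \<rho>))
       \<and> (\<forall>r n rs \<rho>. prime_interval r \<longrightarrow> up_perspective p r \<longrightarrow> swing_sequence pos r q n rs \<rho> \<longrightarrow>
            (\<forall>i\<in>{1..n}. snd (rs (i - 1)) \<ge> snd (rs i)))"
proof (intro conjI allI impI ballI)
  interpret SPS_lattice pos
    using assms(1-3) by unfold_locales
  have "collapses (con p) q \<longleftrightarrow> swing_forced p q"
  proof
    obtain \<theta> where \<theta>: "lattice_congruence \<theta>"
        "\<And>I. prime_interval I \<Longrightarrow> collapses \<theta> I \<longleftrightarrow> swing_forced p I"
      using ex_congruence_collapsing_edges[of "swing_forced p"]
        swing_forced_prime swing_forced_sup swing_forced_inf by blast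
    \<comment> \<open>\<open>p\<close> forces itself, with \<open>r = p\<close> and no steps, so
      \<open>con p\<close> lies in the congruence \<open>\<theta>\<close> that collapses only forced
      edges.\<close>
    have "up_perspective p p"
      using assms(4) covered_by_less[of "fst p" "snd p"]
      by (simp add: up_perspective_def prime_interval_def inf.absorb2 sup.absorb1 less_imp_le)
    then have "swing_forced p p" using assms(4) unfolding swing_forced_def by blast
    then have "con p \<subseteq> \<theta>" using \<theta> assms(4) by (intro con_least) auto
    moreover assume "collapses (con p) q"
    ultimately show "swing_forced p q" using \<theta>(2)[OF assms(5)] by (auto simp: collapses_def)
  qed (rule swing_forced_collapses)
  then show "collapses (con p) q \<longleftrightarrow>
      (\<exists>r n rs \<rho>. prime_interval r \<and> up_perspective p r \<and> swing_sequence pos r q n rs \<rho>)"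
    using swing_reach_iff_sequence[of _ pos q] unfolding swing_forced_def by blast
next
  fix r n rs \<rho> i
  assume "swing_sequence pos r q n rs \<rho>" "i \<in> {1..n}"
  then have "\<rho> i = down_perspective \<or> \<rho> i = swings pos" "\<rho> i (rs (i - 1)) (rs i)"
    unfolding swing_sequence_def by blast+
  \<comment> \<open>A swing keeps the top, and in a down-perspectivity the old top is a join
    containing the new one.\<close>
  then have "down_perspective (rs (i - 1)) (rs i) \<or> swings pos (rs (i - 1)) (rs i)" by metis
  then show "snd (rs i) \<le> snd (rs (i - 1))"
    by (auto simp: down_perspective_def swings_def)
qed

end
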